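(* Fix $\alpha\in(0,1)$ and let $(P_i)_{i\ge0}$ be the $\alpha$-random walk in $\mathbb{Z}^2$. For $i\ge1$ let $X_i=1$ if $P_i$ is visible and $X_i=0$ otherwise, and put $\overline S_n=\frac{X_1+\cdots+X_n}{n}$. Then $$\lim_{n\to\infty}\overline S_n=\frac{6}{\pi^2}\quad\text{almost surely.}$$
   Context: The $\alpha$-random walk is defined by $P_0=(0,0)$ and, for $i\ge0$, $P_{i+1}=P_i+(1,0)$ with probability $\alpha$ and $P_{i+1}=P_i+(0,1)$ with probability $1-\alpha$, the steps being independent. A lattice point $(a,b)$ is called visible (from the origin) if $\gcd(a,b)=1$. *)

theory Defs
  imports "HOL-Probability.Probability"
begin

text \<open>The alpha-random walk is driven by an i.i.d. sequence of steps
  omega :: bool stream, distributed as stream_space (bernoulli_pmf alpha);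
  step j (the (j+1)-th step) is (1,0) if snth omega j = True (probability alpha)
  and (0,1) otherwise. P_0 = (0,0).\<close>

definition walk :: "bool stream \<Rightarrow> nat \<Rightarrow> int \<times> int" where
  "walk \<omega> i = (int (card {j. j < i \<and> \<omega> !! j}),
                int (card {j. j < i \<and> \<not> \<omega> !! j}))"

definition visible :: "int \<times> int \<Rightarrow> bool" where
  "visible p = (gcd (fst p) (snd p) = 1)"

definition walk_space :: "real \<Rightarrow> bool stream measure" where
  "walk_space \<alpha> = stream_space (measure_pmf (bernoulli_pmf \<alpha>))"

end

theory Submission
  imports Defs "HOL-Computational_Algebra.Squarefree" "HOL-Real_Asymp.Real_Asymp"
begin

text \<open>Let \<open>K i\<close> be the number of horizontal steps among the first \<open>i\<close>. The point after \<open>i\<close> steps is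
  visible iff \<open>i\<close> and \<open>K i\<close> are coprime, so Moebius inversion writes the number of visible points as
  a sum over \<open>d\<close> of \<open>\<mu>(d) N(n, d)\<close>, where \<open>N(n, d)\<close> counts the \<open>i \<le> n\<close> with \<open>d\<close> dividing both \<open>i\<close> and
  \<open>K i\<close>. Expanding the condition \<open>d dvd K i\<close> in \<open>d\<close>-th roots of unity \<open>z\<close> reduces everything to
  \<open>E (z ^ (K i - K l)) = \<phi>(z) ^ (i - l)\<close> with \<open>\<phi>(z) = 1 - \<alpha> + \<alpha> z\<close>, which has modulus below 1 for
  \<open>z \<noteq> 1\<close>. For small \<open>d\<close> the second moment shows that \<open>N(n, d)\<close> is close to \<open>n / d\<^sup>2\<close> in mean; for
  large \<open>d\<close> the first moment of \<open>N(n, d)\<close> is small. The resulting error in mean is a negative power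
  of \<open>n\<close>, which gives almost sure convergence along the sequence of \<open>p\<close>-th powers for large \<open>p\<close>, and
  monotonicity of the counts fills the gaps. The limit is the sum of \<open>\<mu>(d) / d\<^sup>2\<close>, the inverse of
  \<open>\<zeta>(2)\<close>.\<close>

section \<open>The Moebius function\<close>

definition moebius_mu :: "nat \<Rightarrow> real" where
  "moebius_mu n = (if squarefree n then (- 1) ^ card (prime_factors n) else 0)"

lemma abs_moebius_mu_le_1: "\<bar>moebius_mu n\<bar> \<le> 1"
  by (simp add: moebius_mu_def power_abs)

lemma moebius_mu_prime_mult:
  assumes "prime p" "\<not> p dvd d"
  shows "moebius_mu (p * d) = - moebius_mu d"
proof (cases "squarefree d")
  case True
  have "coprime p d"
    using assms by (simp add: prime_imp_coprime)
  then have "squarefree (p * d)"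
    using True assms(1) by (simp add: squarefree_mult_coprime squarefree_prime)
  moreover have "prime_factors (p * d) = insert p (prime_factors d)" "p \<notin> prime_factors d"
    using assms by (cases "d = 0"; auto simp: prime_factors_product prime_prime_factors)+
  ultimately show ?thesis
    using True by (simp add: moebius_mu_def)
next
  case False
  then show ?thesis
    using squarefree_multD(2)[of p d] by (auto simp: moebius_mu_def)
qed

text \<open>For a prime \<open>p\<close> dividing \<open>n\<close>, multiplication by \<open>p\<close> pairs the squarefree divisors of \<open>n\<close>
  prime to \<open>p\<close> with those divisible by \<open>p\<close>, and it changes the sign of the summand.\<close>
lemma sum_moebius_mu_divisors:
  assumes "n > 0"
  shows "(\<Sum>d | d dvd n. moebius_mu d) = (if n = 1 then 1 else 0)"
proof (cases "n = 1")
  case False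
  then obtain p where p: "prime p" "p dvd n"
    using prime_factor_nat by blast
  define A where "A = {d. d dvd n \<and> squarefree d \<and> \<not> p dvd d}"
  define B where "B = {d. d dvd n \<and> squarefree d \<and> p dvd d}"
  have fin: "finite {d. d dvd n}"
    using assms by simp
  then have "finite A" "finite B"
    by (auto simp: A_def B_def intro: finite_subset)
  have "p > 0"
    using p(1) by (simp add: prime_gt_0_nat)
  have "bij_betw ((*) p) A B"
  proof (rule bij_betw_imageI)
    show "inj_on ((*) p) A"
      using \<open>p > 0\<close> by (auto simp: inj_on_def)
    show "(*) p ` A = B"
    proof (intro equalityI subsetI)
      fix x assume "x \<in> (*) p ` A"
      then obtain d where d: "x = p * d" "d dvd n" "squarefree d" "\<not> p dvd d"
        by (auto simp: A_def)
      then have "coprime p d"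
        using p(1) by (simp add: prime_imp_coprime)
      then show "x \<in> B"
        using d p by (auto simp: B_def squarefree_mult_coprime squarefree_prime divides_mult)
    next
      fix x assume x: "x \<in> B"
      then obtain d where d: "x = p * d"
        by (auto simp: B_def)
      have "\<not> p dvd d"
      proof
        assume "p dvd d"
        then have "p\<^sup>2 dvd x"
          by (simp add: d power2_eq_square)
        then show False
          using x p(1) squarefreeD[of x p] by (auto simp: B_def)
      qed
      then have "d \<in> A"
        using x unfolding d A_def B_def by (auto dest: dvd_mult_right squarefree_multD)
      then show "x \<in> (*) p ` A"
        using d by auto
    qed
  qed
  then have "(\<Sum>d\<in>B. moebius_mu d) = (\<Sum>d\<in>A. moebius_mu (p * d))"
    by (rule sum.reindex_bij_betw[symmetric])
  also have "\<dots> = - (\<Sum>d\<in>A. moebius_mu d)"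
    using p by (simp add: moebius_mu_prime_mult A_def sum_negf)
  finally have "(\<Sum>d\<in>A \<union> B. moebius_mu d) = 0"
    using \<open>finite A\<close> \<open>finite B\<close> by (subst sum.union_disjoint) (auto simp: A_def B_def)
  moreover have "(\<Sum>d | d dvd n. moebius_mu d) = (\<Sum>d\<in>A \<union> B. moebius_mu d)"
    using fin by (intro sum.mono_neutral_right) (auto simp: A_def B_def moebius_mu_def)
  ultimately show ?thesis
    using False by simp
qed (simp add: moebius_mu_def)

text \<open>Both sides run over the pairs (d, k) of positive numbers with product at most N, grouped
  on the left by d and on the right by the product.\<close>

lemma sum_multiples_eq_sum_divisors:
  fixes f :: "nat \<Rightarrow> nat \<Rightarrow> real"
  shows "(\<Sum>d=1..N. \<Sum>k=1..N div d. f d (d * k)) = (\<Sum>n=1..N. \<Sum>d | d dvd n. f d n)"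
proof -
  have "(\<Sum>d=1..N. \<Sum>k=1..N div d. f d (d * k)) =
      (\<Sum>(d, k)\<in>(SIGMA d:{1..N}. {1..N div d}). f d (d * k))"
    by (simp add: sum.Sigma)
  also have "\<dots> = (\<Sum>(n, d)\<in>(SIGMA n:{1..N}. {d. d dvd n}). f d n)"
    by (rule sum.reindex_bij_witness[of _ "\<lambda>(n, d). (d, n div d)" "\<lambda>(d, k). (d * k, d)"])
       (auto simp: less_eq_div_iff_mult_less_eq mult.commute dvd_div_eq_0_iff Suc_le_eq
          intro!: Nat.gr0I intro: order.trans[OF dvd_imp_le])
  also have "\<dots> = (\<Sum>n=1..N. \<Sum>d | d dvd n. f d n)"
    by (subst sum.Sigma) auto
  finally show ?thesis .
qed

section \<open>The value of the sum of mu(d) / d^2\<close>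

lemma summable_inverse_squares_real: "summable (\<lambda>d. 1 / (real d)\<^sup>2)"
  using inverse_power_summable[of 2, where 'a = real] by (simp add: inverse_eq_divide)

lemma filterlim_div_at_top_nat:
  assumes "d > 0"
  shows "filterlim (\<lambda>n::nat. n div d) at_top sequentially"
  unfolding filterlim_at_top
proof
  fix Z :: nat
  show "\<forall>\<^sub>F n in sequentially. Z \<le> n div d"
    using eventually_ge_at_top[of "Z * d"]
    by eventually_elim (use assms in \<open>simp add: less_eq_div_iff_mult_less_eq\<close>)
qed

text \<open>A finite form of the product of this series with zeta(2): weighting \<open>b d\<close>
  by the partial sum \<open>G (N div d)\<close> and regrouping by n = d * k leaves only n = 1, so
  the total is exactly 1 for every N >= 1. Tannery's theorem then allows N to tend to infinity term
  by term.\<close>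

lemma moebius_mu_inverse_squares_sums: "(\<lambda>d. moebius_mu d / (real d)\<^sup>2) sums (6 / pi\<^sup>2)"
proof -
  define b where "b d = moebius_mu d / (real d)\<^sup>2" for d
  define G where "G m = (\<Sum>k=1..m. 1 / (real k)\<^sup>2)" for m
  have G_eq: "G m = (\<Sum>k<m. 1 / (real k + 1)\<^sup>2)" for m
    unfolding G_def by (rule sum.reindex_bij_witness[of _ Suc "\<lambda>k. k - 1"]) (auto simp: of_nat_diff)
  have G_lim: "G \<longlonglongrightarrow> pi\<^sup>2 / 6"
    using inverse_squares_sums unfolding sums_def G_eq by (simp add: add.commute)
  have G_le: "G m \<le> pi\<^sup>2 / 6" for m
    unfolding G_eq using inverse_squares_sums
    by (subst sums_unique[OF inverse_squares_sums])
       (auto intro!: sum_le_suminf sums_summable simp: add.commute)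
  have G_nonneg: "G m \<ge> 0" for m
    by (simp add: G_def sum_nonneg)
  have norm_b: "norm (b d) \<le> 1 / (real d)\<^sup>2" for d
    using abs_moebius_mu_le_1[of d] by (simp add: b_def divide_right_mono)
  have "norm (b d * G (N div d)) \<le> 1 / (real d)\<^sup>2 * (pi\<^sup>2 / 6)" for N d
    using norm_b[of d] G_le[of "N div d"] G_nonneg[of "N div d"]
    unfolding norm_mult by (intro mult_mono) auto
  then have "(\<lambda>N. \<Sum>d. b d * G (N div d)) \<longlonglongrightarrow> (\<Sum>d. b d * (pi\<^sup>2 / 6))"
  proof (intro conjunct2[OF conjunct2[OF tannerys_theorem[where M = "\<lambda>d. 1 / (real d)\<^sup>2 * (pi\<^sup>2 / 6)"]]])
    fix d show "(\<lambda>N. b d * G (N div d)) \<longlonglongrightarrow> b d * (pi\<^sup>2 / 6)"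
    proof (cases "d = 0")
      case False
      then show ?thesis
        by (intro tendsto_mult_left filterlim_compose[OF G_lim] filterlim_div_at_top_nat) auto
    qed (simp add: b_def)
  qed (use summable_mult2[OF summable_inverse_squares_real, of "pi\<^sup>2 / 6"]
      in \<open>auto intro!: always_eventually\<close>)
  moreover have "(\<Sum>d. b d * G (N div d)) = 1" if "N \<ge> 1" for N
  proof -
    have "(\<Sum>d. b d * G (N div d)) = (\<Sum>d=1..N. b d * G (N div d))"
      \<comment> \<open>For d > N the sum \<open>G (N div d)\<close> is empty, and
        \<open>b 0 = 0\<close> because division by zero gives 0.\<close>
      by (rule suminf_finite) (auto simp: b_def G_def Suc_le_eq)
    also have "\<dots> = (\<Sum>d=1..N. \<Sum>k=1..N div d. moebius_mu d / (real (d * k))\<^sup>2)"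
      by (simp add: b_def G_def sum_distrib_left power_mult_distrib)
    also have "\<dots> = (\<Sum>n=1..N. \<Sum>d | d dvd n. moebius_mu d / (real n)\<^sup>2)"
      by (rule sum_multiples_eq_sum_divisors)
    also have "\<dots> = (\<Sum>n=1..N. if n = 1 then 1 else 0)"
      by (intro sum.cong refl) (auto simp flip: sum_divide_distrib simp: sum_moebius_mu_divisors)
    finally show ?thesis
      using that by simp
  qed
  then have "\<forall>\<^sub>F N in sequentially. (\<Sum>d. b d * G (N div d)) = 1"
    by (auto intro: eventually_sequentiallyI)
  ultimately have "(\<lambda>N::nat. 1) \<longlonglongrightarrow> (\<Sum>d. b d * (pi\<^sup>2 / 6))"
    by (rule Lim_transform_eventually)
  then have "(\<Sum>d. b d * (pi\<^sup>2 / 6)) = 1"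
    using LIMSEQ_unique tendsto_const by blast
  moreover have "summable b"
    by (rule summable_comparison_test'[OF summable_inverse_squares_real norm_b])
  ultimately have "suminf b * (pi\<^sup>2 / 6) = 1"
    using suminf_mult2[of b "pi\<^sup>2 / 6"] by simp
  then have "suminf b = 6 / pi\<^sup>2"
    by (simp add: field_simps)
  then show ?thesis
    using \<open>summable b\<close> unfolding b_def by (simp add: sums_iff)
qed

text \<open>Rounding down \<open>n / d\<close> costs at most 1, so each summand divided by n tends
  to mu(d) / d^2. Since it is also dominated by 1 / d^2, Tannery's theorem handles the growing
  cutoff \<open>D k\<close>, with the summands extended by 0 beyond it.\<close>

lemma moebius_mu_floor_tendsto:
  assumes n: "filterlim n at_top sequentially"
    and D: "filterlim D at_top sequentially"
  shows "(\<lambda>k. (\<Sum>d=1..D k. moebius_mu d * (real (n k div d) / d)) / n k) \<longlonglongrightarrow> 6 / pi\<^sup>2"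
proof -
  define a where "a d k = (if d \<in> {1..D k} then moebius_mu d / d * (real (n k div d) / n k) else 0)"
    for d k
  have lim: "a d \<longlonglongrightarrow> moebius_mu d / (real d)\<^sup>2" for d
  proof (cases "d = 0")
    case False
    have "(\<lambda>n. real (n div d) / real n) \<longlonglongrightarrow> 1 / real d"
    proof (rule tendsto_sandwich)
      show "\<forall>\<^sub>F n in sequentially. 1 / real d - 1 / real n \<le> real (n div d) / real n"
        using eventually_gt_at_top[of 0]
      proof eventually_elim
        case (elim n)
        have "real n \<le> real (n div d) * d + d"
          using div_mult_mod_eq[of n d] mod_less_divisor[of d n] False
          by (metis add_left_mono gr0I less_imp_le_nat of_nat_add of_nat_mono of_nat_mult)
        then have "real n / real d \<le> real (n div d) + 1"
          using False by (simp add: field_simps)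
        then have "(real n / real d - 1) / real n \<le> real (n div d) / real n"
          by (intro divide_right_mono) auto
        then show ?case
          using elim by (simp add: diff_divide_distrib)
      qed
      show "\<forall>\<^sub>F n in sequentially. real (n div d) / real n \<le> 1 / real d"
        using eventually_gt_at_top[of 0]
      proof eventually_elim
        case (elim n)
        have "real (n div d) \<le> real n / real d"
          by (rule of_nat_div_le_of_nat)
        then show ?case
          using elim False by (simp add: field_simps)
      qed
    qed (use False in real_asymp)+
    then have "(\<lambda>k. moebius_mu d / d * (real (n k div d) / n k)) \<longlonglongrightarrow> moebius_mu d / d * (1 / d)"
      by (intro tendsto_mult_left) (rule filterlim_compose[OF _ n])
    moreover have "\<forall>\<^sub>F k in sequentially. moebius_mu d / d * (real (n k div d) / n k) = a d k"
      using D[unfolded filterlim_at_top, rule_format, of d]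
      by eventually_elim (use False in \<open>simp add: a_def\<close>)
    ultimately show ?thesis
      by (simp add: power2_eq_square tendsto_cong)
  qed (simp add: a_def[abs_def])
  have bound: "norm (a d k) \<le> 1 / (real d)\<^sup>2" for d k
  proof -
    have "real (n k div d) / n k \<le> 1 / d"
      using of_nat_div_le_of_nat[of "n k" d] by (cases "n k = 0") (auto simp: field_simps)
    then have "(1 / d) * (real (n k div d) / n k) \<le> 1 / d * (1 / d)"
      by (intro mult_left_mono) auto
    moreover have "\<bar>moebius_mu d\<bar> * ((1 / d) * (real (n k div d) / n k)) \<le> (1 / d) * (real (n k div d) / n k)"
      using abs_moebius_mu_le_1[of d] by (intro mult_left_le_one_le) auto
    ultimately show ?thesis
      by (simp add: a_def abs_mult power2_eq_square)
  qed
  have "(\<lambda>k. \<Sum>d. a d k) \<longlonglongrightarrow> (\<Sum>d. moebius_mu d / (real d)\<^sup>2)"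
    by (intro conjunct2[OF conjunct2[OF tannerys_theorem[where M = "\<lambda>d. 1 / (real d)\<^sup>2"]]])
       (use lim bound in \<open>auto intro!: summable_inverse_squares_real always_eventually\<close>)
  moreover have "(\<Sum>d. a d k) = (\<Sum>d=1..D k. moebius_mu d * (real (n k div d) / d)) / n k" for k
    by (subst suminf_finite[of "{1..D k}"]) (auto simp: a_def sum_divide_distrib)
  ultimately show ?thesis
    using moebius_mu_inverse_squares_sums by (simp add: sums_iff)
qed

section \<open>Independent sequences and almost sure convergence\<close>

lemma (in prob_space) distr_snth: "distr (stream_space M) M (\<lambda>\<omega>. \<omega> !! i) = M"
proof -
  interpret P: product_prob_space "\<lambda>_. M" "UNIV :: nat set" ..
  show ?thesis
    using P.PiM_component[of i]
    by (subst stream_space_eq_distr) (simp add: distr_distr comp_def to_stream_def)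
qed

text \<open>The stream space is the image of the product measure under \<open>to_stream\<close>, and
  reading off coordinates inverts this map. The joint law of the coordinates is thus the product
  measure, which characterises independence.\<close>

lemma (in prob_space) indep_vars_snth:
  "prob_space.indep_vars (stream_space M) (\<lambda>_. M) (\<lambda>i \<omega>. \<omega> !! i) UNIV"
proof -
  interpret S: prob_space "stream_space M"
    by (rule prob_space_stream_space)
  have snth_to_stream: "(!!) (to_stream X) = X" for X :: "nat \<Rightarrow> 'a"
    by (simp add: fun_eq_iff to_stream_def)
  have "distr (stream_space M) (\<Pi>\<^sub>M i\<in>UNIV. M) (\<lambda>\<omega> i. \<omega> !! i) =
      distr (\<Pi>\<^sub>M i\<in>UNIV. M) (\<Pi>\<^sub>M i\<in>UNIV. M) (\<lambda>x. x)"
    by (subst stream_space_eq_distr, subst distr_distr)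
       (simp_all add: comp_def snth_to_stream measurable_snth_PiM)
  then show ?thesis
    by (subst S.indep_vars_iff_distr_eq_PiM') (simp_all add: distr_snth restrict_def)
qed

lemma (in prob_space)
  fixes g :: "nat \<Rightarrow> 'a \<Rightarrow> 'b::{real_normed_field, banach, second_countable_topology}"
  assumes "finite I" "\<And>i. i \<in> I \<Longrightarrow> integrable M (g i)"
  shows integrable_prod_snth: "integrable (stream_space M) (\<lambda>\<omega>. \<Prod>i\<in>I. g i (\<omega> !! i))"
    and integral_prod_snth:
      "(\<integral>\<omega>. (\<Prod>i\<in>I. g i (\<omega> !! i)) \<partial>stream_space M) = (\<Prod>i\<in>I. \<integral>x. g i x \<partial>M)"
proof -
  interpret S: prob_space "stream_space M"
    by (rule prob_space_stream_space)
  have int: "integrable (stream_space M) (\<lambda>\<omega>. g i (\<omega> !! i))" if "i \<in> I" for i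
    using assms(2)[OF that] by (intro integrable_distr[OF measurable_snth]) (simp add: distr_snth)
  have eq: "(\<integral>\<omega>. g i (\<omega> !! i) \<partial>stream_space M) = (\<integral>x. g i x \<partial>M)" if "i \<in> I" for i
    using assms(2)[OF that] integral_distr[OF measurable_snth, of "g i" M i] by (simp add: distr_snth)
  have "S.indep_vars (\<lambda>_. M) (\<lambda>i \<omega>. \<omega> !! i) I"
    using S.indep_vars_subset[OF indep_vars_snth] by simp
  then have indep: "S.indep_vars (\<lambda>_. borel) (\<lambda>i \<omega>. g i (\<omega> !! i)) I"
    by (rule S.indep_vars_compose2) (use assms(2) in auto)
  show "integrable (stream_space M) (\<lambda>\<omega>. \<Prod>i\<in>I. g i (\<omega> !! i))"
    by (rule S.indep_vars_integrable[OF assms(1) indep int])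
  show "(\<integral>\<omega>. (\<Prod>i\<in>I. g i (\<omega> !! i)) \<partial>stream_space M) = (\<Prod>i\<in>I. \<integral>x. g i x \<partial>M)"
    using S.indep_vars_lebesgue_integral[OF assms(1) indep int] eq by simp
qed

text \<open>The variance of the absolute value is nonnegative.\<close>

lemma (in prob_space) expectation_abs_le_sqrt:
  fixes X :: "'a \<Rightarrow> real"
  assumes "integrable M X" "integrable M (\<lambda>x. (X x)\<^sup>2)"
  shows "expectation (\<lambda>x. \<bar>X x\<bar>) \<le> sqrt (expectation (\<lambda>x. (X x)\<^sup>2))"
proof (rule real_le_rsqrt)
  show "(expectation (\<lambda>x. \<bar>X x\<bar>))\<^sup>2 \<le> expectation (\<lambda>x. (X x)\<^sup>2)"
    using variance_positive[of "\<lambda>x. \<bar>X x\<bar>"] variance_eq[of "\<lambda>x. \<bar>X x\<bar>"] assms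
    by simp
qed

text \<open>The series of the X k has finite expectation, hence converges almost surely, and the
  terms of a convergent series tend to 0.\<close>

lemma (in prob_space) AE_tendsto_0_if_summable_expectation:
  fixes X :: "nat \<Rightarrow> 'a \<Rightarrow> real"
  assumes int: "\<And>k. integrable M (X k)" and nonneg: "\<And>k x. X k x \<ge> 0"
    and le: "\<And>k. expectation (X k) \<le> c k" and c: "summable c"
  shows "AE x in M. (\<lambda>k. X k x) \<longlonglongrightarrow> 0"
proof -
  have [measurable]: "X k \<in> borel_measurable M" for k
    using int by auto
  have c_nonneg: "c k \<ge> 0" for k
    using Bochner_Integration.integral_nonneg[of M "X k"] le[of k] nonneg by fastforce
  have "(\<integral>\<^sup>+x. (\<Sum>k. ennreal (X k x)) \<partial>M) = (\<Sum>k. \<integral>\<^sup>+x. ennreal (X k x) \<partial>M)"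
    by (rule nn_integral_suminf) simp
  also have "\<dots> = (\<Sum>k. ennreal (expectation (X k)))"
    by (intro suminf_cong nn_integral_eq_integral int) (simp add: nonneg)
  also have "\<dots> \<le> (\<Sum>k. ennreal (c k))"
    by (intro suminf_le ennreal_leI le) auto
  also have "\<dots> < \<infinity>"
    using suminf_ennreal_eq[OF c_nonneg summable_sums[OF c]] by simp
  finally have "(\<integral>\<^sup>+x. (\<Sum>k. ennreal (X k x)) \<partial>M) \<noteq> \<infinity>"
    by simp
  then have "AE x in M. (\<Sum>k. ennreal (X k x)) \<noteq> \<infinity>"
    by (rule nn_integral_noteq_infinite[rotated]) simp
  then show ?thesis
    by eventually_elim (auto intro!: summable_LIMSEQ_zero summable_suminf_not_top nonneg)
qed

text \<open>Along \<open>n = k ^ p\<close> consecutive indices have ratio tending to 1, so bounded averages cannot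
  oscillate in between.\<close>
lemma averages_tendsto_if_powers:
  fixes a :: "nat \<Rightarrow> real"
  assumes a: "\<And>i. 0 \<le> a i" and p: "p > 0"
    and lim: "(\<lambda>k. (\<Sum>i=1..k ^ p. a i) / real (k ^ p)) \<longlonglongrightarrow> L"
  shows "(\<lambda>n. (\<Sum>i=1..n. a i) / real n) \<longlonglongrightarrow> L"
proof -
  define S where "S n = (\<Sum>i=1..n. a i)" for n
  define r where "r n = nat \<lfloor>root p (real n)\<rfloor>" for n
  have mono: "S m \<le> S n" if "m \<le> n" for m n
    unfolding S_def using that a by (intro sum_mono2) auto
  have S_nonneg: "S n \<ge> 0" for n
    using a by (simp add: S_def sum_nonneg)
  have r_le: "r n ^ p \<le> n" for n
  proof -
    have "real (r n) \<le> root p (real n)"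
      unfolding r_def by (rule of_nat_floor) (simp add: p)
    then have "real (r n) ^ p \<le> root p (real n) ^ p"
      by (intro power_mono) auto
    also have "\<dots> = real n"
      using p by simp
    finally show ?thesis
      by (simp flip: of_nat_power)
  qed
  have le_r: "n \<le> Suc (r n) ^ p" for n
  proof -
    have "root p (real n) \<le> real (Suc (r n))"
      by (simp add: r_def) linarith
    then have "root p (real n) ^ p \<le> real (Suc (r n)) ^ p"
      using p by (intro power_mono) auto
    moreover have "root p (real n) ^ p = real n"
      using p by simp
    ultimately show ?thesis
      by (metis of_nat_le_iff of_nat_power)
  qed
  have r_lim: "filterlim r at_top sequentially"
    unfolding filterlim_at_top
  proof
    fix Z :: nat
    show "\<forall>\<^sub>F n in sequentially. Z \<le> r n"
      using eventually_ge_at_top[of "Z ^ p"]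
    proof eventually_elim
      case (elim n)
      then have "root p (real (Z ^ p)) \<le> root p (real n)"
        using p by (intro real_root_le_mono) auto
      then show ?case
        using p by (simp add: r_def real_root_power_cancel le_nat_floor)
    qed
  qed
  \<comment> \<open>By monotonicity of \<open>S\<close>, the average at n lies between
    \<open>S (r ^ p) / (r + 1) ^ p\<close> and \<open>S ((r + 1) ^ p) / r ^ p\<close> with r =
    \<open>r n\<close>. These differ from the averages at exact powers only by this ratio.\<close>
  have ratio: "(\<lambda>k. (real k / real (Suc k)) ^ p) \<longlonglongrightarrow> 1 ^ p"
    by (intro tendsto_power) real_asymp
  have lower: "(\<lambda>k. S (k ^ p) / real (k ^ p) * (real k / real (Suc k)) ^ p) \<longlonglongrightarrow> L"
    using tendsto_mult[OF lim ratio] by (simp add: S_def)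
  have "(\<lambda>k. S (Suc k ^ p) / real (Suc k ^ p)) \<longlonglongrightarrow> L"
    using LIMSEQ_Suc[OF lim] by (simp add: S_def)
  then have upper: "(\<lambda>k. S (Suc k ^ p) / real (Suc k ^ p) / (real k / real (Suc k)) ^ p) \<longlonglongrightarrow> L"
    using tendsto_divide[OF _ ratio] by fastforce
  have r_pos: "\<forall>\<^sub>F n in sequentially. r n > 0"
    using r_lim eventually_gt_at_top[of 0] by (rule eventually_compose_filterlim[rotated])
  have "(\<lambda>n. S n / real n) \<longlonglongrightarrow> L"
  proof (rule tendsto_sandwich)
    show "\<forall>\<^sub>F n in sequentially.
        S (r n ^ p) / real (r n ^ p) * (real (r n) / real (Suc (r n))) ^ p \<le> S n / real n"
      using r_pos
    proof eventually_elim
      case (elim n)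
      have n: "n > 0"
        using elim p r_le[of n] by (metis gr0I le_zero_eq power_eq_0_iff less_irrefl)
      have "S (r n ^ p) / real (r n ^ p) * (real (r n) / real (Suc (r n))) ^ p =
          S (r n ^ p) / real (Suc (r n) ^ p)"
        using elim by (simp add: power_divide)
      also have "\<dots> \<le> S n / real n"
        using n by (intro frac_le mono r_le S_nonneg of_nat_mono le_r) simp
      finally show ?case .
    qed
    show "\<forall>\<^sub>F n in sequentially. S n / real n \<le>
        S (Suc (r n) ^ p) / real (Suc (r n) ^ p) / (real (r n) / real (Suc (r n))) ^ p"
      using r_pos
    proof eventually_elim
      case (elim n)
      have "S n / real n \<le> S (Suc (r n) ^ p) / real (r n ^ p)"
        using elim by (intro frac_le mono r_le S_nonneg of_nat_mono le_r) simp
      also have "\<dots> = S (Suc (r n) ^ p) / real (Suc (r n) ^ p) / (real (r n) / real (Suc (r n))) ^ p"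
        by (simp add: power_divide del: of_nat_Suc)
      finally show ?case .
    qed
  qed (rule filterlim_compose[OF lower r_lim] filterlim_compose[OF upper r_lim])+
  then show ?thesis
    by (simp add: S_def)
qed

section \<open>Roots of unity and the characteristic function of a step\<close>

text \<open>On the left half of the interval concavity puts the sine above its chord, and the
  reflection of x to 1 - x covers the right half. The bound is weak, but it is a single polynomial
  that vanishes at both ends.\<close>

lemma sin_pi_mult_ge:
  fixes x :: real
  assumes "0 \<le> x" "x \<le> 1"
  shows "x * (1 - x) \<le> sin (pi * x)"
proof -
  have half: "x \<le> sin (pi * x)" if "0 \<le> x" "x \<le> 1 / 2" for x :: real
  proof -
    have "concave_on {0..pi / 2} sin"
    proof (rule f''_le0_imp_concave)
      show "(sin has_real_derivative cos x) (at x)" for x :: real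
        by (auto intro!: derivative_eq_intros)
      show "(cos has_real_derivative - sin x) (at x)" for x :: real
        by (auto intro!: derivative_eq_intros)
      show "- sin x \<le> 0" if "x \<in> {0..pi / 2}" for x
        using that by (auto intro!: sin_ge_zero)
    qed simp
    from concave_onD[OF this, of "2 * x" 0 "pi / 2"] that
    have "2 * x \<le> sin (pi * x)"
      by (simp add: mult.commute)
    then show ?thesis
      using that by linarith
  qed
  show ?thesis
  proof (cases "x \<le> 1 / 2")
    case True
    have "x * (1 - x) \<le> x * 1"
      using assms by (intro mult_left_mono) auto
    then show ?thesis
      using half[of x] True assms by linarith
  next
    case False
    have "x * (1 - x) \<le> 1 * (1 - x)"
      using assms by (intro mult_right_mono) auto
    also have "\<dots> \<le> sin (pi * (1 - x))"
      using half[of "1 - x"] False assms by simp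
    also have "\<dots> = sin (pi * x)"
      by (simp add: right_diff_distrib)
    finally show ?thesis .
  qed
qed

lemma sum_geometric_le:
  fixes r :: real
  assumes "0 \<le> r" "r < 1" "finite A"
  shows "(\<Sum>k\<in>A. r ^ k) \<le> 1 / (1 - r)"
  using assms sum_le_suminf[of "\<lambda>k. r ^ k" A] by (simp add: suminf_geometric summable_geometric)

text \<open>With truncated subtraction the exponent is the distance of i and l. Each distance occurs
  at most once on either side of i, so two geometric series suffice.\<close>

lemma sum_geometric_distance_le:
  fixes r :: real
  assumes r: "0 \<le> r" "r < 1" and "finite A"
  shows "(\<Sum>l\<in>A. r ^ ((i - l) + (l - i))) \<le> 2 / (1 - r)"
proof -
  have "(\<Sum>l\<in>A. r ^ ((i - l) + (l - i))) =
      (\<Sum>l\<in>{l \<in> A. l \<le> i} \<union> {l \<in> A. i < l}. r ^ ((i - l) + (l - i)))"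
    by (intro sum.cong) auto
  also have "\<dots> = (\<Sum>l\<in>{l \<in> A. l \<le> i}. r ^ ((i - l) + (l - i))) +
      (\<Sum>l\<in>{l \<in> A. i < l}. r ^ ((i - l) + (l - i)))"
    using \<open>finite A\<close> by (intro sum.union_disjoint) auto
  also have "(\<Sum>l\<in>{l \<in> A. l \<le> i}. r ^ ((i - l) + (l - i))) = (\<Sum>l\<in>{l \<in> A. l \<le> i}. r ^ (i - l))"
    by (intro sum.cong) auto
  also have "(\<Sum>l\<in>{l \<in> A. i < l}. r ^ ((i - l) + (l - i))) = (\<Sum>l\<in>{l \<in> A. i < l}. r ^ (l - i))"
    by (intro sum.cong) auto
  also have "(\<Sum>l\<in>{l \<in> A. l \<le> i}. r ^ (i - l)) = (\<Sum>k\<in>(\<lambda>l. i - l) ` {l \<in> A. l \<le> i}. r ^ k)"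
    by (subst sum.reindex) (auto simp: inj_on_def)
  also have "(\<Sum>l\<in>{l \<in> A. i < l}. r ^ (l - i)) = (\<Sum>k\<in>(\<lambda>l. l - i) ` {l \<in> A. i < l}. r ^ k)"
    by (subst sum.reindex) (auto simp: inj_on_def)
  also have "(\<Sum>k\<in>(\<lambda>l. i - l) ` {l \<in> A. l \<le> i}. r ^ k) +
      (\<Sum>k\<in>(\<lambda>l. l - i) ` {l \<in> A. i < l}. r ^ k) \<le> 1 / (1 - r) + 1 / (1 - r)"
    using assms by (intro add_mono sum_geometric_le) auto
  finally show ?thesis
    by simp
qed

text \<open>Telescoping, since each summand is at most 2 * (sqrt j - sqrt (j - 1)).\<close>

lemma sum_inverse_sqrt_le: "(\<Sum>j=1..n. 1 / sqrt (real j)) \<le> 2 * sqrt (real n)"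
proof (induction n)
  case (Suc n)
  define a b where "a = sqrt (real (Suc n))" and "b = sqrt (real n)"
  have ab: "b \<le> a" "a > 0" "(a - b) * (a + b) = 1"
    by (simp_all add: a_def b_def algebra_simps)
  have "(a - b) * (a + b) \<le> (a - b) * (2 * a)"
    using ab by (intro mult_left_mono) auto
  then have "1 / a \<le> 2 * (a - b)"
    using ab by (simp add: field_simps)
  then show ?case
    using Suc by (simp add: a_def b_def)
qed simp

text \<open>Trades exponential decay for a power that is easy to sum over the roots of
  unity.\<close>

lemma exp_minus_le_powr:
  fixes u a :: real
  assumes "u > 0" "0 \<le> a" "a \<le> 1"
  shows "exp (- u) \<le> u powr - a"
proof -
  have "u powr a \<le> exp u"
  proof (cases "u \<le> 1")
    case True
    then have "u powr a \<le> 1"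
      using assms by (simp add: powr_le1)
    also have "1 \<le> exp u"
      using assms by simp
    finally show ?thesis .
  next
    case False
    then have "u powr a \<le> u powr 1"
      using assms by (intro powr_mono) auto
    also have "\<dots> \<le> exp u"
      using assms exp_ge_add_one_self[of u] by (simp del: exp_ge_add_one_self)
    finally show ?thesis .
  qed
  then show ?thesis
    using assms by (simp add: exp_minus powr_minus)
qed

definition root_of_unity :: "nat \<Rightarrow> nat \<Rightarrow> complex" where
  "root_of_unity d j = cis (2 * pi * (real j / real d))"

lemma norm_root_of_unity [simp]: "norm (root_of_unity d j) = 1"
  by (simp add: root_of_unity_def)

lemma root_of_unity_0 [simp]: "root_of_unity d 0 = 1"
  by (simp add: root_of_unity_def)

lemma sum_root_of_unity_power:
  assumes "d > 0"
  shows "(\<Sum>j<d. root_of_unity d j ^ m) = (if d dvd m then of_nat d else 0)"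
proof -
  \<comment> \<open>The roles of j and m are exchanged: the m-th power of the j-th root is the j-th
    power of the m-th root, so the sum is geometric in j.\<close>
  define w where "w = root_of_unity d m"
  have "root_of_unity d j ^ m = w ^ j" for j
    by (simp only: w_def root_of_unity_def Complex.DeMoivre times_divide_eq_right mult_ac)
  moreover have "w = exp (2 * of_real pi * \<i> * of_nat m / of_nat d)"
    by (simp add: w_def root_of_unity_def cis_conv_exp field_simps)
  then have "w = 1 \<longleftrightarrow> d dvd m" "w ^ d = 1"
    using complex_root_unity_eq_1[of d m] complex_root_unity[of d m] assms by simp_all
  ultimately show ?thesis
    using geometric_sum[of w d] by (auto simp: lessThan_atLeast0)
qed

section \<open>Decay of the characteristic function at roots of unity\<close>

locale bernoulli_walk =
  fixes \<alpha> :: real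
  assumes \<alpha>_pos: "0 < \<alpha>" and \<alpha>_less_1: "\<alpha> < 1"
begin

text \<open>The mean of the factor that one step contributes to
  \<open>z ^ heads \<omega> i\<close>.\<close>

definition char_fun :: "complex \<Rightarrow> complex" where
  "char_fun z = of_real (1 - \<alpha>) + of_real \<alpha> * z"

text \<open>The variance of the indicator of a horizontal step.\<close>

definition \<beta> :: real where "\<beta> = \<alpha> * (1 - \<alpha>)"

lemma \<beta>_pos: "\<beta> > 0"
  using \<alpha>_pos \<alpha>_less_1 by (simp add: \<beta>_def)

lemma char_fun_1 [simp]: "char_fun 1 = 1"
  by (simp add: char_fun_def flip: of_real_add)

lemma norm_char_fun_cis: "(norm (char_fun (cis t)))\<^sup>2 = 1 - 4 * \<beta> * (sin (t / 2))\<^sup>2"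
proof -
  have "(norm (char_fun (cis t)))\<^sup>2 = (1 - \<alpha> + \<alpha> * cos t)\<^sup>2 + (\<alpha> * sin t)\<^sup>2"
    by (simp add: char_fun_def cmod_power2)
  also have "\<dots> = (1 - \<alpha>)\<^sup>2 + 2 * \<beta> * cos t + \<alpha>\<^sup>2 * ((sin t)\<^sup>2 + (cos t)\<^sup>2)"
    unfolding \<beta>_def by algebra
  also have "\<dots> = (1 - \<alpha>)\<^sup>2 + 2 * \<beta> * cos t + \<alpha>\<^sup>2"
    by simp
  also have "cos t = 1 - 2 * (sin (t / 2))\<^sup>2"
    using cos_double_sin[of "t / 2"] by simp
  finally show ?thesis
    by (simp add: \<beta>_def power2_eq_square algebra_simps)
qed

text \<open>Half-angle formula and 1 - 4t <= (1 - 2t)^2 with t = \<open>\<beta> * s\<^sup>2\<close>,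
  where s is the sine; the polynomial lower bound for the sine finishes.\<close>

lemma norm_char_fun_root_of_unity_le:
  assumes "j < d"
  shows "norm (char_fun (root_of_unity d j)) \<le> 1 - 2 * \<beta> * (j / d * (1 - j / d))\<^sup>2"
proof -
  define s where "s = sin (pi * (j / d))"
  have "0 \<le> j / d * (1 - j / d)"
    using assms by simp
  moreover have "j / d * (1 - j / d) \<le> s"
    unfolding s_def using assms by (intro sin_pi_mult_ge) auto
  ultimately have "(j / d * (1 - j / d))\<^sup>2 \<le> s\<^sup>2"
    by (simp add: power_mono)
  then have "1 - 2 * \<beta> * s\<^sup>2 \<le> 1 - 2 * \<beta> * (j / d * (1 - j / d))\<^sup>2"
    using \<beta>_pos by simp
  moreover have "norm (char_fun (root_of_unity d j)) \<le> 1 - 2 * \<beta> * s\<^sup>2"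
  proof (rule power2_le_imp_le)
    show "(norm (char_fun (root_of_unity d j)))\<^sup>2 \<le> (1 - 2 * \<beta> * s\<^sup>2)\<^sup>2"
      by (simp add: root_of_unity_def norm_char_fun_cis s_def power2_diff)
    \<comment> \<open>Taking square roots requires the right-hand side to be nonnegative.\<close>
    have "\<beta> \<le> 1 / 4"
      using zero_le_power2[of "\<alpha> - 1 / 2"] by (simp add: \<beta>_def power2_eq_square field_simps)
    moreover have "s\<^sup>2 \<le> 1"
      by (simp add: s_def abs_square_le_1)
    ultimately have "\<beta> * s\<^sup>2 \<le> 1 / 4 * 1"
      using \<beta>_pos by (intro mult_mono) auto
    then show "0 \<le> 1 - 2 * \<beta> * s\<^sup>2"
      by simp
  qed
  ultimately show ?thesis
    by linarith
qed

text \<open>A gap below 1 that is uniform over the nontrivial roots. The product j * (d - j) of two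
  positive integers is at least half of their sum d, so x * (1 - x) >= 1 / (2 * d) for x = j /
  d.\<close>

lemma norm_char_fun_le_gap:
  assumes "1 \<le> j" "j < d"
  shows "norm (char_fun (root_of_unity d j)) \<le> 1 - \<beta> / (2 * (real d)\<^sup>2)"
proof -
  have "real d / 2 \<le> real j * (real d - real j)"
  proof -
    have "d \<le> 2 * (j * (d - j))"
    proof -
      obtain a where a: "d = j + a" "a \<ge> 1"
        using assms by (metis less_imp_add_positive One_nat_def Suc_leI)
      have "j * 1 \<le> j * a" "1 * a \<le> j * a"
        using a assms by (intro mult_le_mono; simp)+
      then have "j + a \<le> 2 * (j * a)"
        unfolding mult_1 mult_1_right mult_2 by (rule add_mono)
      then show ?thesis
        by (simp only: a(1) diff_add_inverse)
    qed
    then have "real d \<le> real (2 * (j * (d - j)))"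
      by (simp only: of_nat_le_iff)
    then show ?thesis
      using assms by (simp add: of_nat_diff)
  qed
  then have "real d / 2 / (real d)\<^sup>2 \<le> real j * (real d - real j) / (real d)\<^sup>2"
    by (intro divide_right_mono) auto
  then have "1 / (2 * real d) \<le> j / d * (1 - j / d)"
    using assms by (simp add: field_simps power2_eq_square)
  then have "(1 / (2 * real d))\<^sup>2 \<le> (j / d * (1 - j / d))\<^sup>2"
    by (intro power_mono) auto
  then have "2 * \<beta> * (1 / (2 * real d))\<^sup>2 \<le> 2 * \<beta> * (j / d * (1 - j / d))\<^sup>2"
    using \<beta>_pos by (intro mult_left_mono) auto
  moreover have "2 * \<beta> * (1 / (2 * real d))\<^sup>2 = \<beta> / (2 * (real d)\<^sup>2)"
    by (simp add: power2_eq_square)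
  ultimately show ?thesis
    using norm_char_fun_root_of_unity_le[OF assms(2)] by linarith
qed

text \<open>The true order of the resulting bound on the probability that \<open>d\<close> divides the number of
  heads is \<open>d powr (- 1 / 2)\<close>; the exponent \<open>- 1 / 4\<close> is cheaper, and any negative exponent makes the
  sum over \<open>d\<close> of the expected counts converge.\<close>
lemma norm_char_fun_power_le:
  assumes "1 \<le> j" "j < d" "d \<le> i"
  shows "norm (char_fun (root_of_unity d j)) ^ i \<le>
    (2 * \<beta> * d) powr (- 1 / 4) * sqrt d * (1 / sqrt j + 1 / sqrt (real d - j))"
proof -
  define x where "x = real j / real d"
  define r where "r = norm (char_fun (root_of_unity d j))"
  have x: "0 < x" "x < 1"
    using assms by (auto simp: x_def)
  have r: "0 \<le> r" "r \<le> 1 - 2 * \<beta> * (x * (1 - x))\<^sup>2"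
    using norm_char_fun_root_of_unity_le[OF assms(2)] by (simp_all add: r_def x_def)
  moreover have "0 \<le> 2 * \<beta> * (x * (1 - x))\<^sup>2"
    using \<beta>_pos by simp
  ultimately have "r \<le> 1"
    by linarith
  have "r \<le> exp (- (2 * \<beta> * (x * (1 - x))\<^sup>2))"
    using r(2) exp_ge_add_one_self[of "- (2 * \<beta> * (x * (1 - x))\<^sup>2)"] by linarith
  then have "r ^ d \<le> exp (- (2 * \<beta> * (x * (1 - x))\<^sup>2)) ^ d"
    using r(1) by (rule power_mono)
  also have "\<dots> = exp (- (2 * \<beta> * d * (x * (1 - x))\<^sup>2))"
    by (simp add: exp_of_nat_mult[symmetric] mult_ac)
  \<comment> \<open>The exponent 1 / 4 turns the squared product into the inverse square root of x *
    (1 - x), whose singularities at both ends are summable.\<close>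
  also have "\<dots> \<le> (2 * \<beta> * d * (x * (1 - x))\<^sup>2) powr - (1 / 4)"
    using assms x \<beta>_pos by (intro exp_minus_le_powr) auto
  also have "\<dots> = (2 * \<beta> * d) powr (- 1 / 4) * (1 / sqrt (x * (1 - x)))"
  proof -
    have "((x * (1 - x))\<^sup>2) powr - (1 / 4) = (x * (1 - x)) powr - (1 / 2)"
      using x by (simp add: powr_powr flip: powr_numeral)
    also have "\<dots> = 1 / sqrt (x * (1 - x))"
      using x by (simp add: powr_minus_divide powr_half_sqrt)
    finally show ?thesis
      using x \<beta>_pos by (simp add: powr_mult)
  qed
  \<comment> \<open>Subadditivity of the square root separates the singularity at 0 from the one at
    1.\<close>
  also have "1 / sqrt (x * (1 - x)) \<le> 1 / sqrt x + 1 / sqrt (1 - x)"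
  proof -
    have "1 \<le> sqrt x + sqrt (1 - x)"
      using sqrt_add_le_add_sqrt[of x "1 - x"] x by simp
    then have "1 / (sqrt x * sqrt (1 - x)) \<le> (sqrt x + sqrt (1 - x)) / (sqrt x * sqrt (1 - x))"
      using x by (intro divide_right_mono) auto
    also have "\<dots> = 1 / sqrt x + 1 / sqrt (1 - x)"
      using x by (simp add: field_simps)
    finally show ?thesis
      by (simp add: real_sqrt_mult)
  qed
  also have "1 / sqrt x + 1 / sqrt (1 - x) = sqrt d * (1 / sqrt j + 1 / sqrt (real d - j))"
  proof -
    have "1 - x = (real d - j) / d"
      using assms by (simp add: x_def field_simps)
    then show ?thesis
      by (simp add: x_def real_sqrt_divide distrib_left)
  qed
  finally have "r ^ d \<le> (2 * \<beta> * d) powr (- 1 / 4) * sqrt d * (1 / sqrt j + 1 / sqrt (real d - j))"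
    using \<beta>_pos by (simp add: mult.assoc mult_left_mono)
  moreover have "r ^ i \<le> r ^ d"
    using r(1) \<open>r \<le> 1\<close> assms(3) by (intro power_decreasing)
  ultimately show ?thesis
    by (simp add: r_def)
qed

text \<open>The 1 pays for the trivial root j = 0, which contributes 1 / d. The 4 is 2 * 2: two sums
  exchanged by j to d - j, each at most 2 * sqrt d.\<close>

definition tail_const :: real where
  "tail_const = 1 + 4 * (2 * \<beta>) powr (- 1 / 4)"

text \<open>By Fourier expansion, the left side bounds the probability that d divides the number of
  heads after i steps.\<close>

lemma sum_norm_char_fun_power_le:
  assumes "d \<ge> 1" "d \<le> i"
  shows "(\<Sum>j<d. norm (char_fun (root_of_unity d j)) ^ i) / d \<le> tail_const * d powr (- 1 / 4)"
proof -
  define c where "c = (2 * \<beta> * d) powr (- 1 / 4)"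
  have reflect: "(\<Sum>j=1..<d. 1 / sqrt (real d - j)) = (\<Sum>j=1..<d. 1 / sqrt (real j))"
    by (rule sum.reindex_bij_witness[of _ "\<lambda>j. d - j" "\<lambda>j. d - j"]) (auto simp: of_nat_diff)
  have "(\<Sum>j=1..<d. norm (char_fun (root_of_unity d j)) ^ i) \<le>
      (\<Sum>j=1..<d. c * sqrt d * (1 / sqrt j + 1 / sqrt (real d - j)))"
    unfolding c_def using assms(2) by (intro sum_mono norm_char_fun_power_le) auto
  also have "\<dots> = c * sqrt d * (2 * (\<Sum>j=1..<d. 1 / sqrt (real j)))"
    by (simp only: sum_distrib_left[symmetric] sum.distrib reflect) simp
  also have "\<dots> \<le> c * sqrt d * (2 * (2 * sqrt (real d)))"
    by (intro mult_left_mono order.trans[OF _ sum_inverse_sqrt_le] sum_mono2) (auto simp: c_def)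
  also have "\<dots> = 4 * c * d"
    by simp
  finally have "(\<Sum>j<d. norm (char_fun (root_of_unity d j)) ^ i) \<le> 1 + 4 * c * d"
    using assms by (simp add: lessThan_atLeast0 sum.atLeast_Suc_lessThan)
  then have "(\<Sum>j<d. norm (char_fun (root_of_unity d j)) ^ i) / d \<le> (1 + 4 * c * d) / d"
    by (intro divide_right_mono) auto
  also have "\<dots> = d powr - 1 + 4 * (2 * \<beta>) powr (- 1 / 4) * d powr (- 1 / 4)"
    using assms \<beta>_pos by (simp add: c_def powr_mult add_divide_distrib powr_minus_divide)
  also have "\<dots> \<le> d powr (- 1 / 4) + 4 * (2 * \<beta>) powr (- 1 / 4) * d powr (- 1 / 4)"
    using assms by (intro add_right_mono powr_mono) auto
  finally show ?thesis
    by (simp add: tail_const_def distrib_right)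
qed

end

section \<open>Common divisors along the walk\<close>

text \<open>The first coordinate of \<open>walk\<close>, kept as a natural number so that it can be
  an exponent.\<close>

definition heads :: "bool stream \<Rightarrow> nat \<Rightarrow> nat" where
  "heads \<omega> i = card {j. j < i \<and> \<omega> !! j}"

lemma heads_le: "heads \<omega> i \<le> i"
proof -
  have "heads \<omega> i \<le> card {..<i}"
    unfolding heads_def by (intro card_mono) auto
  then show ?thesis
    by simp
qed

lemma heads_eq_sum: "heads \<omega> i = (\<Sum>j<i. if \<omega> !! j then 1 else 0)"
  unfolding heads_def by (simp add: sum.If_cases Collect_conj_eq lessThan_def)

lemma power_heads_eq_prod: "z ^ heads \<omega> i = (\<Prod>j<i. if \<omega> !! j then z else 1)"
  unfolding heads_def by (simp add: prod.If_cases Collect_conj_eq lessThan_def)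

text \<open>The two coordinates add up to i, so replacing one of them by i does not change the
  gcd.\<close>

lemma visible_walk_iff:
  "visible (walk \<omega> i) \<longleftrightarrow> coprime i (heads \<omega> i)"
proof -
  have "card {j. j < i \<and> \<not> \<omega> !! j} + heads \<omega> i = card ({j. j < i \<and> \<not> \<omega> !! j} \<union> {j. j < i \<and> \<omega> !! j})"
    unfolding heads_def by (rule card_Un_disjoint[symmetric]) auto
  also have "{j. j < i \<and> \<not> \<omega> !! j} \<union> {j. j < i \<and> \<omega> !! j} = {..<i}"
    by auto
  finally have "i = card {j. j < i \<and> \<not> \<omega> !! j} + heads \<omega> i"
    by simp
  then have "coprime i (heads \<omega> i) \<longleftrightarrow> coprime (card {j. j < i \<and> \<not> \<omega> !! j}) (heads \<omega> i)"
    by (metis coprime_iff_gcd_eq_1 gcd_add1)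
  then show ?thesis
    by (simp add: visible_def walk_def heads_def coprime_commute coprime_iff_gcd_eq_1)
qed

text \<open>This is N(n, d); its deterministic main term will be
  \<open>real (n div d) / d\<close>.\<close>

definition common_count :: "nat \<Rightarrow> nat \<Rightarrow> bool stream \<Rightarrow> real" where
  "common_count n d \<omega> = (\<Sum>i | i \<in> {1..n} \<and> d dvd i. if d dvd heads \<omega> i then 1 else 0)"

lemma common_count_nonneg: "0 \<le> common_count n d \<omega>"
  by (simp add: common_count_def sum_nonneg)

lemma card_multiples:
  assumes "d > 0"
  shows "card {i. i \<in> {1..n} \<and> d dvd i} = n div d"
proof -
  have "{i. i \<in> {1..n} \<and> d dvd i} = (*) d ` {1..n div d}"
    using assms
    by (auto simp: less_eq_div_iff_mult_less_eq mult.commute Suc_le_eq elim!: dvdE)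
  then show ?thesis
    using assms by (simp add: card_image inj_on_def)
qed

text \<open>Moebius inversion for the gcd of i and the number of heads. The gcd is at most i <= n,
  so d can run up to n for every i, which permits swapping the sums over i and d.\<close>

lemma visible_indicator_eq_sum:
  assumes "i \<in> {1..n}"
  shows "(if visible (walk \<omega> i) then 1 else 0) =
    (\<Sum>d=1..n. moebius_mu d * (if d dvd i then if d dvd heads \<omega> i then 1 else 0 else 0))"
proof -
  define g where "g = gcd i (heads \<omega> i)"
  have "g > 0" "g \<le> n"
    using assms order.trans[OF gcd_le1_nat[of i "heads \<omega> i"], of n] by (auto simp: g_def)
  have "(if visible (walk \<omega> i) then 1 else 0) = (if g = 1 then 1 else (0 :: real))"
    by (simp add: visible_walk_iff g_def coprime_iff_gcd_eq_1)
  also have "\<dots> = (\<Sum>d | d dvd g. moebius_mu d)"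
    using \<open>g > 0\<close> by (simp add: sum_moebius_mu_divisors)
  also have "\<dots> = (\<Sum>d\<in>{d \<in> {1..n}. d dvd g}. moebius_mu d)"
    using \<open>g > 0\<close> \<open>g \<le> n\<close>
    by (intro sum.cong) (auto simp: Suc_le_eq intro!: Nat.gr0I dest: dvd_imp_le)
  also have "\<dots> = (\<Sum>d=1..n. if d dvd g then moebius_mu d else 0)"
    by (rule sum.inter_filter) simp
  also have "\<dots> = (\<Sum>d=1..n. moebius_mu d * (if d dvd i then if d dvd heads \<omega> i then 1 else 0 else 0))"
    by (intro sum.cong) (auto simp: g_def)
  finally show ?thesis .
qed

lemma sum_visible_eq:
  "(\<Sum>i=1..n. if visible (walk \<omega> i) then 1 else 0) =
    (\<Sum>d=1..n. moebius_mu d * common_count n d \<omega>)"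
proof -
  have "(\<Sum>i=1..n. if visible (walk \<omega> i) then 1 else 0) =
      (\<Sum>i=1..n. \<Sum>d=1..n. moebius_mu d * (if d dvd i then if d dvd heads \<omega> i then 1 else 0 else 0))"
    by (intro sum.cong refl visible_indicator_eq_sum)
  also have "\<dots> = (\<Sum>d=1..n. moebius_mu d *
      (\<Sum>i=1..n. if d dvd i then if d dvd heads \<omega> i then 1 else 0 else 0))"
    by (subst sum.swap) (simp add: sum_distrib_left)
  also have "\<dots> = (\<Sum>d=1..n. moebius_mu d * common_count n d \<omega>)"
    unfolding common_count_def
    by (subst sum.inter_filter[symmetric]) simp_all
  finally show ?thesis .
qed

section \<open>First and second moments of the common divisor counts\<close>

context bernoulli_walk
begin

abbreviation W :: "bool stream measure" where
  "W \<equiv> walk_space \<alpha>"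

sublocale W: prob_space W
  unfolding walk_space_def by (intro prob_space.prob_space_stream_space measure_pmf.prob_space_axioms)

lemma measurable_snth_W [measurable]: "(\<lambda>\<omega>. \<omega> !! j) \<in> measurable W (count_space UNIV)"
  using measurable_snth[of j "measure_pmf (bernoulli_pmf \<alpha>)"]
  unfolding walk_space_def by simp

lemma measurable_heads [measurable]: "(\<lambda>\<omega>. heads \<omega> i) \<in> measurable W (count_space UNIV)"
  unfolding heads_eq_sum by measurable

lemma measurable_fun_heads:
  fixes f :: "nat \<Rightarrow> 'b::topological_space"
  shows "(\<lambda>\<omega>. f (heads \<omega> i)) \<in> borel_measurable W"
  by (rule measurable_compose[OF measurable_heads]) simp

text \<open>The number of heads takes only finitely many values, so any function of it is
  bounded.\<close>

lemma integrable_fun_heads [simp, intro]: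
  fixes f :: "nat \<Rightarrow> 'b::{banach, second_countable_topology}"
  shows "integrable W (\<lambda>\<omega>. f (heads \<omega> i))"
proof (rule W.integrable_const_bound)
  show "AE \<omega> in W. norm (f (heads \<omega> i)) \<le> (\<Sum>k\<le>i. norm (f k))"
    by (intro AE_I2 member_le_sum) (auto simp: heads_le)
qed (rule measurable_fun_heads)

text \<open>As z has modulus 1, the conjugate cancels the first l steps. The other i - l steps are
  independent and contribute one factor \<open>char_fun z\<close> each.\<close>

lemma expectation_power_heads:
  assumes "norm z = 1" "l \<le> i"
  shows "integrable W (\<lambda>\<omega>. z ^ heads \<omega> i * cnj (z ^ heads \<omega> l))"
    and "W.expectation (\<lambda>\<omega>. z ^ heads \<omega> i * cnj (z ^ heads \<omega> l)) = char_fun z ^ (i - l)"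
proof -
  have z: "z * cnj z = 1"
    using assms(1) by (simp flip: complex_norm_square)
  have eq: "z ^ heads \<omega> i * cnj (z ^ heads \<omega> l) = (\<Prod>j\<in>{l..<i}. if \<omega> !! j then z else 1)" for \<omega>
  proof -
    have "{..<i} = {..<l} \<union> {l..<i}"
      using assms(2) by auto
    then have "z ^ heads \<omega> i = z ^ heads \<omega> l * (\<Prod>j\<in>{l..<i}. if \<omega> !! j then z else 1)"
      unfolding power_heads_eq_prod by (simp add: prod.union_disjoint ivl_disj_int)
    moreover have "z ^ heads \<omega> l * cnj (z ^ heads \<omega> l) = 1"
      by (simp add: z flip: power_mult_distrib)
    ultimately show ?thesis
      by (simp add: mult_ac)
  qed
  have int: "integrable (measure_pmf (bernoulli_pmf \<alpha>)) (\<lambda>b. if b then z else 1)"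
    by (rule integrable_measure_pmf_finite) simp
  have exp: "measure_pmf.expectation (bernoulli_pmf \<alpha>) (\<lambda>b. if b then z else 1) = char_fun z"
    using \<alpha>_pos \<alpha>_less_1
    by (subst integral_measure_pmf[of UNIV])
       (auto simp: UNIV_bool char_fun_def scaleR_conv_of_real algebra_simps)
  show "integrable W (\<lambda>\<omega>. z ^ heads \<omega> i * cnj (z ^ heads \<omega> l))"
    unfolding eq walk_space_def by (intro measure_pmf.integrable_prod_snth int) simp
  show "W.expectation (\<lambda>\<omega>. z ^ heads \<omega> i * cnj (z ^ heads \<omega> l)) = char_fun z ^ (i - l)"
    unfolding eq walk_space_def by (subst measure_pmf.integral_prod_snth) (simp_all add: int exp)
qed

text \<open>Conjugation reduces i < l to the previous case and preserves the modulus; truncated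
  subtraction again encodes the distance.\<close>

lemma expectation_power_heads_distance:
  assumes "norm z = 1"
  shows "integrable W (\<lambda>\<omega>. z ^ heads \<omega> i * cnj (z ^ heads \<omega> l))" (is ?int)
    and "norm (W.expectation (\<lambda>\<omega>. z ^ heads \<omega> i * cnj (z ^ heads \<omega> l))) =
      norm (char_fun z) ^ ((i - l) + (l - i))" (is ?eq)
proof -
  have "?int \<and> ?eq"
  proof (cases "l \<le> i")
    case True
    then show ?thesis
      using expectation_power_heads[OF assms True] by (simp add: norm_power)
  next
    case False
    have eq: "(\<lambda>\<omega>. z ^ heads \<omega> i * cnj (z ^ heads \<omega> l)) =
        (\<lambda>\<omega>. cnj (z ^ heads \<omega> l * cnj (z ^ heads \<omega> i)))"
      by (simp add: mult.commute)
    have "i \<le> l"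
      using False by simp
    note swapped = expectation_power_heads[OF assms this]
    have ?int
      unfolding eq using swapped(1) by (rule integrable_cnj)
    moreover have ?eq
      unfolding eq Bochner_Integration.integral_cnj complex_mod_cnj swapped(2) using False by (simp add: norm_power)
    ultimately show ?thesis ..
  qed
  then show ?int ?eq
    by auto
qed

text \<open>Expanding the square gives correlations that decay geometrically in the distance of i
  and l. Each row has a bounded sum, so the second moment grows only linearly in the size of
  I.\<close>

lemma expectation_sum_power_heads_le:
  assumes z: "norm z = 1" and r: "norm (char_fun z) < 1" and "finite I"
  shows "W.expectation (\<lambda>\<omega>. (norm (\<Sum>i\<in>I. z ^ heads \<omega> i))\<^sup>2) \<le> card I * (2 / (1 - norm (char_fun z)))"
proof -
  note int = expectation_power_heads_distance(1)[OF z]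
  have eq: "complex_of_real ((norm (\<Sum>i\<in>I. z ^ heads \<omega> i))\<^sup>2) =
      (\<Sum>i\<in>I. \<Sum>l\<in>I. z ^ heads \<omega> i * cnj (z ^ heads \<omega> l))" for \<omega>
    by (simp only: complex_norm_square cnj_sum sum_product)
  have "complex_of_real (W.expectation (\<lambda>\<omega>. (norm (\<Sum>i\<in>I. z ^ heads \<omega> i))\<^sup>2)) =
      W.expectation (\<lambda>\<omega>. complex_of_real ((norm (\<Sum>i\<in>I. z ^ heads \<omega> i))\<^sup>2))"
    by (rule integral_complex_of_real[symmetric])
  also have "\<dots> = (\<Sum>i\<in>I. \<Sum>l\<in>I. W.expectation (\<lambda>\<omega>. z ^ heads \<omega> i * cnj (z ^ heads \<omega> l)))"
    unfolding eq by (subst Bochner_Integration.integral_sum, (intro Bochner_Integration.integrable_sum int)[1])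
      (intro sum.cong refl Bochner_Integration.integral_sum int)
  finally have expectation_eq:
    "complex_of_real (W.expectation (\<lambda>\<omega>. (norm (\<Sum>i\<in>I. z ^ heads \<omega> i))\<^sup>2)) =
      (\<Sum>i\<in>I. \<Sum>l\<in>I. W.expectation (\<lambda>\<omega>. z ^ heads \<omega> i * cnj (z ^ heads \<omega> l)))" .
  have "W.expectation (\<lambda>\<omega>. (norm (\<Sum>i\<in>I. z ^ heads \<omega> i))\<^sup>2) \<le>
      norm (complex_of_real (W.expectation (\<lambda>\<omega>. (norm (\<Sum>i\<in>I. z ^ heads \<omega> i))\<^sup>2)))"
    by (simp only: norm_of_real abs_ge_self)
  also have "\<dots> \<le> (\<Sum>i\<in>I. \<Sum>l\<in>I. norm (char_fun z) ^ ((i - l) + (l - i)))"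
    unfolding expectation_eq
    by (intro sum_norm_le order.trans[OF norm_sum] sum_mono)
       (rule eq_refl, rule expectation_power_heads_distance(2)[OF z])
  also have "\<dots> \<le> (\<Sum>i\<in>I. 2 / (1 - norm (char_fun z)))"
    using r \<open>finite I\<close> by (intro sum_mono sum_geometric_distance_le) auto
  finally show ?thesis
    by simp
qed

lemma dvd_indicator_eq_sum:
  assumes "d > 0"
  shows "complex_of_real (if d dvd m then 1 else 0) = (\<Sum>j<d. root_of_unity d j ^ m) / d"
  using assms by (simp add: sum_root_of_unity_power)

lemma prob_dvd_heads_le:
  assumes "d \<ge> 1" "d \<le> i"
  shows "W.expectation (\<lambda>\<omega>. if d dvd heads \<omega> i then 1 else 0) \<le> tail_const * d powr (- 1 / 4)"
proof -
  have power: "integrable W (\<lambda>\<omega>. root_of_unity d j ^ heads \<omega> i)"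
    "W.expectation (\<lambda>\<omega>. root_of_unity d j ^ heads \<omega> i) = char_fun (root_of_unity d j) ^ i" for j
    \<comment> \<open>With l = 0 the conjugated factor is 1.\<close>
    using expectation_power_heads[of "root_of_unity d j" 0 i] by (simp_all add: heads_def)
  have "complex_of_real (W.expectation (\<lambda>\<omega>. if d dvd heads \<omega> i then 1 else 0)) =
      W.expectation (\<lambda>\<omega>. complex_of_real (if d dvd heads \<omega> i then 1 else 0))"
    by (rule integral_complex_of_real[symmetric])
  also have "\<dots> = W.expectation (\<lambda>\<omega>. (\<Sum>j<d. root_of_unity d j ^ heads \<omega> i) / d)"
    using assms by (subst dvd_indicator_eq_sum) auto
  also have "\<dots> = (\<Sum>j<d. char_fun (root_of_unity d j) ^ i) / d"
    using power by simp
  finally have "W.expectation (\<lambda>\<omega>. if d dvd heads \<omega> i then 1 else 0) \<le>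
      norm ((\<Sum>j<d. char_fun (root_of_unity d j) ^ i) / d)"
    by (metis norm_of_real abs_ge_self)
  also have "\<dots> \<le> (\<Sum>j<d. norm (char_fun (root_of_unity d j)) ^ i) / d"
    unfolding norm_divide by (auto intro!: divide_right_mono sum_norm_le simp: norm_power)
  also have "\<dots> \<le> tail_const * d powr (- 1 / 4)"
    by (rule sum_norm_char_fun_power_le[OF assms])
  finally show ?thesis .
qed

lemma integrable_common_count [simp, intro]: "integrable W (common_count n d)"
  unfolding common_count_def[abs_def] by (intro Bochner_Integration.integrable_sum integrable_fun_heads)

text \<open>At most n / d indices are multiples of d, and each positive multiple is at least d, so
  the probability bound applies. The exponent - 1 - 1 / 4 is summable over d.\<close>

lemma expectation_common_count_le:
  assumes "d \<ge> 1"
  shows "W.expectation (common_count n d) \<le> real n * tail_const * d powr (- 5 / 4)"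
proof -
  have "W.expectation (common_count n d) =
      (\<Sum>i | i \<in> {1..n} \<and> d dvd i. W.expectation (\<lambda>\<omega>. if d dvd heads \<omega> i then 1 else 0))"
    unfolding common_count_def[abs_def]
    by (intro Bochner_Integration.integral_sum integrable_fun_heads)
  also have "\<dots> \<le> (\<Sum>i | i \<in> {1..n} \<and> d dvd i. tail_const * d powr (- 1 / 4))"
    using assms by (intro sum_mono prob_dvd_heads_le) (auto dest: dvd_imp_le)
  also have "\<dots> = real (n div d) * (tail_const * d powr (- 1 / 4))"
    using assms card_multiples[of d n] by simp
  also have "\<dots> \<le> (real n / real d) * (tail_const * d powr (- 1 / 4))"
    by (intro mult_right_mono of_nat_div_le_of_nat) (simp add: tail_const_def)
  also have "\<dots> = real n * tail_const * (d powr - 1 * d powr (- 1 / 4))"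
    using assms by (simp add: powr_minus_divide)
  also have "d powr - 1 * d powr (- 1 / 4) = d powr (- 5 / 4)"
    by (simp only: powr_add[symmetric]) simp
  finally show ?thesis .
qed

text \<open>In the Fourier expansion the trivial root gives exactly the main term. Every other root
  has a small second moment by the gap of order d^(-2), and the first absolute moment is at most its
  square root.\<close>

lemma expectation_common_count_deviation_le:
  assumes "d \<ge> 1"
  shows "W.expectation (\<lambda>\<omega>. \<bar>common_count n d \<omega> - real (n div d) / d\<bar>) \<le> 2 * real d * sqrt (n / \<beta>)"
proof -
  define I where "I = {i. i \<in> {1..n} \<and> d dvd i}"
  define S where "S j \<omega> = norm (\<Sum>i\<in>I. root_of_unity d j ^ heads \<omega> i)" for j \<omega>
  have "finite I"
    by (simp add: I_def)
  have card_I: "card I = n div d"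
    using assms card_multiples[of d n] by (simp add: I_def)
  have le: "\<bar>common_count n d \<omega> - real (n div d) / d\<bar> \<le> (\<Sum>j=1..<d. S j \<omega>) / d" for \<omega>
  proof -
    have "complex_of_real (common_count n d \<omega>) =
        (\<Sum>i\<in>I. complex_of_real (if d dvd heads \<omega> i then 1 else 0))"
      by (simp add: common_count_def I_def)
    also have "\<dots> = (\<Sum>i\<in>I. (\<Sum>j<d. root_of_unity d j ^ heads \<omega> i) / d)"
      using assms by (subst dvd_indicator_eq_sum) auto
    also have "\<dots> = (\<Sum>j<d. \<Sum>i\<in>I. root_of_unity d j ^ heads \<omega> i) / d"
      by (subst sum.swap) (simp add: sum_divide_distrib)
    \<comment> \<open>The root j = 0 equals 1, so its inner sum is the cardinality of
      \<open>I\<close>.\<close>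
    also have "\<dots> = (of_nat (n div d) + (\<Sum>j=1..<d. \<Sum>i\<in>I. root_of_unity d j ^ heads \<omega> i)) / d"
      using assms by (simp add: lessThan_atLeast0 sum.atLeast_Suc_lessThan card_I)
    finally have "complex_of_real (common_count n d \<omega> - real (n div d) / d) =
        (\<Sum>j=1..<d. \<Sum>i\<in>I. root_of_unity d j ^ heads \<omega> i) / d"
      by (simp add: add_divide_distrib)
    then have "\<bar>common_count n d \<omega> - real (n div d) / d\<bar> =
        norm (\<Sum>j=1..<d. \<Sum>i\<in>I. root_of_unity d j ^ heads \<omega> i) / d"
      by (metis norm_of_real norm_divide norm_of_nat)
    also have "\<dots> \<le> (\<Sum>j=1..<d. S j \<omega>) / d"
      unfolding S_def by (intro divide_right_mono norm_sum) auto
    finally show ?thesis .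
  qed
  have S_le: "S j \<omega> \<le> card I" for j \<omega>
  proof -
    have "S j \<omega> \<le> (\<Sum>i\<in>I. 1)"
      unfolding S_def by (intro sum_norm_le) (simp add: norm_power)
    then show ?thesis
      by simp
  qed
  have S_nonneg: "0 \<le> S j \<omega>" for j \<omega>
    by (simp add: S_def)
  have S_meas [measurable]: "S j \<in> borel_measurable W" for j
    unfolding S_def[abs_def]
    by (intro measurable_compose[OF _ borel_measurable_norm] borel_measurable_sum measurable_fun_heads)
  have S_int: "integrable W (S j)" for j
    by (rule W.integrable_const_bound[of _ "card I"]) (use S_le S_nonneg in auto)
  have S2_int: "integrable W (\<lambda>\<omega>. (S j \<omega>)\<^sup>2)" for j
    by (rule W.integrable_const_bound[of _ "(card I)\<^sup>2"])
       (use S_le S_nonneg in \<open>auto intro!: power_mono\<close>)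
  have S_exp: "W.expectation (S j) \<le> 2 * real d * sqrt (n / \<beta>)" if j: "j \<in> {1..<d}" for j
  proof -
    define r where "r = norm (char_fun (root_of_unity d j))"
    have r: "r \<le> 1 - \<beta> / (2 * (real d)\<^sup>2)"
      unfolding r_def using j by (intro norm_char_fun_le_gap) auto
    have gap: "0 < \<beta> / (2 * (real d)\<^sup>2)"
      using \<beta>_pos assms by simp
    have "W.expectation (S j) = W.expectation (\<lambda>\<omega>. \<bar>S j \<omega>\<bar>)"
      using S_nonneg by simp
    also have "\<dots> \<le> sqrt (W.expectation (\<lambda>\<omega>. (S j \<omega>)\<^sup>2))"
      by (rule W.expectation_abs_le_sqrt[OF S_int S2_int])
    also have "\<dots> \<le> sqrt (card I * (2 / (1 - r)))"
      unfolding S_def r_def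
      by (intro real_sqrt_le_mono expectation_sum_power_heads_le)
         (use r gap \<open>finite I\<close> in \<open>auto simp: r_def\<close>)
    also have "\<dots> \<le> sqrt (n * (2 / (\<beta> / (2 * (real d)\<^sup>2))))"
      unfolding card_I using r gap
      by (intro real_sqrt_le_mono mult_mono divide_left_mono mult_pos_pos) auto
    also have "n * (2 / (\<beta> / (2 * (real d)\<^sup>2))) = (2 * real d)\<^sup>2 * (n / \<beta>)"
      using \<beta>_pos by (simp add: field_simps power2_eq_square)
    also have "sqrt \<dots> = 2 * real d * sqrt (n / \<beta>)"
      by (simp only: real_sqrt_mult real_sqrt_abs abs_of_nat abs_mult abs_numeral)
    finally show ?thesis .
  qed
  have "integrable W (\<lambda>\<omega>. \<bar>common_count n d \<omega> - real (n div d) / d\<bar>)"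
    by (intro integrable_abs Bochner_Integration.integrable_diff integrable_common_count W.integrable_const)
  moreover have "integrable W (\<lambda>\<omega>. (\<Sum>j=1..<d. S j \<omega>) / d)"
    by (intro integrable_divide Bochner_Integration.integrable_sum S_int)
  ultimately have "W.expectation (\<lambda>\<omega>. \<bar>common_count n d \<omega> - real (n div d) / d\<bar>) \<le>
      W.expectation (\<lambda>\<omega>. (\<Sum>j=1..<d. S j \<omega>) / d)"
    by (rule integral_mono) (rule le)
  also have "\<dots> = (\<Sum>j=1..<d. W.expectation (S j)) / d"
    using S_int by simp
  also have "\<dots> \<le> (\<Sum>j=1..<d. 2 * real d * sqrt (n / \<beta>)) / d"
    by (intro divide_right_mono sum_mono S_exp) auto
  also have "\<dots> \<le> 2 * real d * sqrt (n / \<beta>)"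
  proof -
    have "real (d - 1) / d * (2 * real d * sqrt (n / \<beta>)) \<le> 1 * (2 * real d * sqrt (n / \<beta>))"
      using assms \<beta>_pos by (intro mult_right_mono) auto
    then show ?thesis
      by simp
  qed
  finally show ?thesis .
qed

section \<open>Truncation at D and almost sure convergence\<close>

definition tail_sum :: real where
  "tail_sum = (\<Sum>d. real d powr (- 9 / 8))"

definition deviation :: "nat \<Rightarrow> nat \<Rightarrow> bool stream \<Rightarrow> real" where
  "deviation n D \<omega> = \<bar>(\<Sum>i=1..n. if visible (walk \<omega> i) then 1 else 0) -
     (\<Sum>d=1..D. moebius_mu d * (real (n div d) / d))\<bar>"

text \<open>Up to the cutoff D the counts are compared with their main terms; beyond it the counts
  themselves are the error.\<close>

lemma deviation_le:
  assumes "D \<le> n"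
  shows "deviation n D \<omega> \<le> (\<Sum>d=1..D. \<bar>common_count n d \<omega> - real (n div d) / d\<bar>) +
    (\<Sum>d\<in>{D<..n}. common_count n d \<omega>)"
proof -
  have "{1..n} = {1..D} \<union> {D<..n}" "{1..D} \<inter> {D<..n} = {}"
    using assms by auto
  then have "(\<Sum>i=1..n. if visible (walk \<omega> i) then 1 else 0) =
      (\<Sum>d=1..D. moebius_mu d * common_count n d \<omega>) + (\<Sum>d\<in>{D<..n}. moebius_mu d * common_count n d \<omega>)"
    unfolding sum_visible_eq by (simp add: sum.union_disjoint)
  then have "deviation n D \<omega> =
      \<bar>(\<Sum>d=1..D. moebius_mu d * (common_count n d \<omega> - real (n div d) / d)) +
       (\<Sum>d\<in>{D<..n}. moebius_mu d * common_count n d \<omega>)\<bar>"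
    by (simp add: deviation_def right_diff_distrib sum_subtractf)
  also have "\<dots> \<le> (\<Sum>d=1..D. \<bar>moebius_mu d * (common_count n d \<omega> - real (n div d) / d)\<bar>) +
      (\<Sum>d\<in>{D<..n}. \<bar>moebius_mu d * common_count n d \<omega>\<bar>)"
    by (intro order.trans[OF abs_triangle_ineq] add_mono sum_abs)
  also have "\<dots> \<le> (\<Sum>d=1..D. \<bar>common_count n d \<omega> - real (n div d) / d\<bar>) +
      (\<Sum>d\<in>{D<..n}. \<bar>common_count n d \<omega>\<bar>)"
    unfolding abs_mult by (intro add_mono sum_mono mult_left_le_one_le abs_moebius_mu_le_1) auto
  finally show ?thesis
    by (simp add: common_count_nonneg)
qed

lemma integrable_deviation [simp, intro]: "integrable W (deviation n D)"
  unfolding deviation_def[abs_def] visible_walk_iff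
  by (intro integrable_abs Bochner_Integration.integrable_diff Bochner_Integration.integrable_sum
      integrable_fun_heads W.integrable_const)

text \<open>The D small divisors cost at most 2 * D * sqrt (n / \<beta>) each, the large ones are a
  tail of a convergent series. The two terms balance in opposite directions, so D has to be a small
  power of n.\<close>

lemma expectation_deviation_le:
  assumes "1 \<le> D" "D \<le> n"
  shows "W.expectation (deviation n D) \<le>
    2 * (real D)\<^sup>2 * sqrt (n / \<beta>) + real n * (tail_const * tail_sum) * D powr (- 1 / 8)"
proof -
  have summable: "summable (\<lambda>d. real d powr (- 9 / 8))"
    by (simp add: summable_real_powr_iff)
  have tail: "W.expectation (common_count n d) \<le>
      real n * tail_const * (D powr (- 1 / 8) * d powr (- 9 / 8))" if d: "d \<in> {D<..n}" for d
  proof -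
    \<comment> \<open>The exponent is split so that 1 / 8 gives decay in D, while the remaining 9 /
      8 > 1 still gives a convergent series.\<close>
    have "real d powr (- 5 / 4) = real d powr (- 1 / 8) * real d powr (- 9 / 8)"
      by (simp flip: powr_add)
    also have "\<dots> \<le> real D powr (- 1 / 8) * real d powr (- 9 / 8)"
      using d assms by (intro mult_right_mono powr_mono2') auto
    finally have "real n * tail_const * d powr (- 5 / 4) \<le>
        real n * tail_const * (D powr (- 1 / 8) * d powr (- 9 / 8))"
      by (intro mult_left_mono) (simp_all add: tail_const_def)
    with d show ?thesis
      by (intro order.trans[OF expectation_common_count_le]) auto
  qed
  have "W.expectation (deviation n D) \<le>
      W.expectation (\<lambda>\<omega>. (\<Sum>d=1..D. \<bar>common_count n d \<omega> - real (n div d) / d\<bar>) +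
        (\<Sum>d\<in>{D<..n}. common_count n d \<omega>))"
    by (intro integral_mono deviation_le assms integrable_deviation Bochner_Integration.integrable_add
        Bochner_Integration.integrable_sum integrable_abs Bochner_Integration.integrable_diff
        integrable_common_count) auto
  also have "\<dots> = (\<Sum>d=1..D. W.expectation (\<lambda>\<omega>. \<bar>common_count n d \<omega> - real (n div d) / d\<bar>)) +
      (\<Sum>d\<in>{D<..n}. W.expectation (common_count n d))"
    by (simp add: Bochner_Integration.integral_add)
  also have "\<dots> \<le> (\<Sum>d=1..D. 2 * real D * sqrt (n / \<beta>)) +
      (\<Sum>d\<in>{D<..n}. real n * tail_const * (D powr (- 1 / 8) * d powr (- 9 / 8)))"
  proof (intro add_mono sum_mono tail)
    fix d assume d: "d \<in> {1..D}"
    have "2 * real d * sqrt (n / \<beta>) \<le> 2 * real D * sqrt (n / \<beta>)"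
      using d \<beta>_pos by (intro mult_right_mono) auto
    then show "W.expectation (\<lambda>\<omega>. \<bar>common_count n d \<omega> - real (n div d) / d\<bar>) \<le> 2 * real D * sqrt (n / \<beta>)"
      using d expectation_common_count_deviation_le[of d n] by simp
  qed
  also have "\<dots> = 2 * (real D)\<^sup>2 * sqrt (n / \<beta>) +
      real n * tail_const * D powr (- 1 / 8) * (\<Sum>d\<in>{D<..n}. real d powr (- 9 / 8))"
    by (simp add: sum_distrib_left power2_eq_square mult_ac)
  also have "\<dots> \<le> 2 * (real D)\<^sup>2 * sqrt (n / \<beta>) +
      real n * tail_const * D powr (- 1 / 8) * tail_sum"
    unfolding tail_sum_def
    by (intro add_left_mono mult_left_mono sum_le_suminf summable) (auto simp: tail_const_def)
  finally show ?thesis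
    by (simp add: mult_ac)
qed

text \<open>For \<open>n = k ^ 128\<close> and \<open>D = k ^ 16\<close> the two error terms, divided by \<open>n\<close>, are of order
  \<open>k powr - 32\<close> and \<open>k powr - 2\<close>, hence summable over \<open>k\<close>.\<close>
lemma AE_deviation_tendsto_0:
  "AE \<omega> in W. (\<lambda>k. deviation (k ^ 128) (k ^ 16) \<omega> / real (k ^ 128)) \<longlonglongrightarrow> 0"
proof (rule W.AE_tendsto_0_if_summable_expectation)
  define C where "C = 2 / sqrt \<beta> + tail_const * tail_sum"
  show "W.expectation (\<lambda>\<omega>. deviation (k ^ 128) (k ^ 16) \<omega> / real (k ^ 128)) \<le> C * (1 / (real k)\<^sup>2)" for k
  \<comment> \<open>For k = 0 both sides are 0 by division by zero.\<close>
  proof (cases "k = 0")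
    case False
    define x where "x = real k"
    have x: "x \<ge> 1"
      using False by (simp add: x_def)
    have sqrt_x: "sqrt (x ^ 128) = x ^ 64"
      using x by (intro real_sqrt_unique) (simp_all flip: power_mult)
    have "(x ^ 16) powr (- 1 / 8) = (x powr 16) powr (- 1 / 8)"
      using powr_realpow[of x 16] x by simp
    also have "\<dots> = x powr - 2"
      unfolding powr_powr by simp
    also have "\<dots> = 1 / x\<^sup>2"
      using x by (simp add: powr_minus_divide)
    finally have powr_x: "(x ^ 16) powr (- 1 / 8) = 1 / x\<^sup>2" .
    have "k ^ 16 \<le> k ^ 128"
      using False by (intro power_increasing) auto
    then have "W.expectation (deviation (k ^ 128) (k ^ 16)) / x ^ 128 \<le>
        (2 * (x ^ 16)\<^sup>2 * sqrt (x ^ 128 / \<beta>) +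
          x ^ 128 * (tail_const * tail_sum) * (x ^ 16) powr (- 1 / 8)) / x ^ 128"
      using expectation_deviation_le[of "k ^ 16" "k ^ 128"] False x
      by (intro divide_right_mono) (simp_all add: x_def)
    also have "\<dots> = 2 / sqrt \<beta> * (1 / x ^ 32) + tail_const * tail_sum * (1 / x\<^sup>2)"
    proof -
      have "(x ^ 16)\<^sup>2 * x ^ 64 * x ^ 32 = x ^ 128"
        by (simp only: power_mult[symmetric] power_add[symmetric]) simp
      then have quotient: "(x ^ 16)\<^sup>2 * x ^ 64 / x ^ 128 = 1 / x ^ 32"
        using x by (simp add: divide_simps)
      have split: "(2 * a * (b / s) + N * t * p) / N = 2 / s * (a * b / N) + t * p"
        if "N \<noteq> 0" for a b s N t p :: real
        using that by (simp add: add_divide_distrib)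
      have nonzero: "x ^ 128 \<noteq> 0"
        using x by simp
      show ?thesis
        unfolding real_sqrt_divide sqrt_x powr_x split[OF nonzero] quotient by (rule refl)
    qed
    also have "\<dots> \<le> 2 / sqrt \<beta> * (1 / x\<^sup>2) + tail_const * tail_sum * (1 / x\<^sup>2)"
    proof (intro add_right_mono mult_left_mono)
      show "1 / x ^ 32 \<le> 1 / x\<^sup>2"
        by (intro divide_left_mono power_increasing mult_pos_pos zero_less_power) (use x in simp_all)
    qed (use \<beta>_pos in simp)
    also have "W.expectation (deviation (k ^ 128) (k ^ 16)) / x ^ 128 =
        W.expectation (\<lambda>\<omega>. deviation (k ^ 128) (k ^ 16) \<omega> / real (k ^ 128))"
      unfolding x_def of_nat_power by (rule integral_divide_zero[symmetric])
    finally show ?thesis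
      by (simp only: C_def x_def distrib_right)
  qed simp
  show "summable (\<lambda>k. C * (1 / (real k)\<^sup>2))"
    by (intro summable_mult summable_inverse_squares_real)
  show "integrable W (\<lambda>\<omega>. deviation (k ^ 128) (k ^ 16) \<omega> / real (k ^ 128))" for k
    by (intro integrable_divide integrable_deviation)
qed (simp add: deviation_def)

lemma AE_visible_average:
  "AE \<omega> in W. (\<lambda>n. (\<Sum>i=1..n. if visible (walk \<omega> i) then 1 else 0) / real n) \<longlonglongrightarrow> 6 / pi\<^sup>2"
  using AE_deviation_tendsto_0
proof eventually_elim
  case (elim \<omega>)
  define S where "S n = (\<Sum>i=1..n. if visible (walk \<omega> i) then 1 else (0 :: real))" for n
  define T where "T n D = (\<Sum>d=1..D. moebius_mu d * (real (n div d) / d))" for n D :: nat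
  define n D where "n k = k ^ 128" and "D k = k ^ 16" for k :: nat
  have lim: "filterlim n at_top sequentially" "filterlim D at_top sequentially"
    unfolding n_def D_def
    by (rule filterlim_at_top_mono[OF filterlim_ident],
        auto intro!: eventually_sequentiallyI[of 1] self_le_power)+
  have "(\<lambda>k. deviation (n k) (D k) \<omega> / real (n k)) \<longlonglongrightarrow> 0"
    using elim by (simp only: n_def D_def)
  then have "(\<lambda>k. \<bar>(S (n k) - T (n k) (D k)) / real (n k)\<bar>) \<longlonglongrightarrow> 0"
    by (simp add: deviation_def S_def T_def abs_divide)
  then have "(\<lambda>k. (S (n k) - T (n k) (D k)) / real (n k)) \<longlonglongrightarrow> 0"
    by (rule tendsto_rabs_zero_cancel)
  moreover have "(\<lambda>k. T (n k) (D k) / real (n k)) \<longlonglongrightarrow> 6 / pi\<^sup>2"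
    unfolding T_def by (rule moebius_mu_floor_tendsto[OF lim])
  ultimately have "(\<lambda>k. (S (n k) - T (n k) (D k)) / real (n k) + T (n k) (D k) / real (n k))
      \<longlonglongrightarrow> 0 + 6 / pi\<^sup>2"
    by (rule tendsto_add)
  then have "(\<lambda>k. S (n k) / real (n k)) \<longlonglongrightarrow> 6 / pi\<^sup>2"
    by (simp add: diff_divide_distrib)
  \<comment> \<open>The indicators are nonnegative, so convergence along the 128-th powers extends
    to all n.\<close>
  then show ?case
    unfolding S_def n_def by (intro averages_tendsto_if_powers[where p = 128]; simp)
qed

end

theorem theorem1:
  fixes \<alpha> :: real
  assumes "0 < \<alpha>" and "\<alpha> < 1"
  shows "AE \<omega> in walk_space \<alpha>.
           (\<lambda>n. (\<Sum>i=1..n. if visible (walk \<omega> i) then 1 else 0) / real n)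
             \<longlonglongrightarrow> 6 / pi\<^sup>2"
proof -
  interpret bernoulli_walk \<alpha>
    using assms by unfold_locales
  show ?thesis
    by (rule AE_visible_average)
qed

end
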